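(* Let $k\ge0$ and let $\varphi$ be a formula of the language of $\mathsf{HA}$. If $\mathsf{HA}+\mathrm{LEM}(\Sigma_k)\vdash\varphi$, then $\mathsf{HA}^{*}+\mathrm{LEM}(\Sigma_k)\vdash\varphi^{*}$.
   Context: $\mathsf{HA}$ is intuitionistic first-order arithmetic with function symbols for all primitive recursive functions and logical constants $\forall,\exists,\to,\land,\lor,\perp$ ($\neg\varphi:\equiv\varphi\to\perp$). $\Sigma_0=\Pi_0$ = quantifier-free formulas; $\Sigma_{m+1}$ = formulas $\exists x_1\cdots\exists x_n\varphi$, $\varphi\in\Pi_m$; $\Pi_{m+1}$ = formulas $\forall x_1\cdots\forall x_n\varphi$, $\varphi\in\Sigma_m$. $\mathrm{LEM}(\Sigma_k)$ is the scheme $\varphi\lor\neg\varphi$ for $\varphi\in\Sigma_k$ of the language of $\mathsf{HA}$ (free variables allowed). $\mathsf{HA}^{*}$ is $\mathsf{HA}$ in the language extended by a $0$-ary predicate symbol $*$ (all schemes, including induction, range over the extended language); in $\mathsf{HA}^{*}+\mathrm{LEM}(\Sigma_k)$ the scheme $\mathrm{LEM}(\Sigma_k)$ is only for formulas of the original language. The Friedman A-translation $\varphi^{*}$ of an $\mathsf{HA}$-formula $\varphi$ is obtained by replacing every prime formula $P$ (including $\perp$) occurring in $\varphi$ by $P\lor *$; officially: $P^*:\equiv P\lor *$ for prime $P$, and $(\cdot)^*$ commutes with $\land,\lor,\to,\forall x,\exists x$. *)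

theory Defs
  imports Main
begin

text \<open>
  Function symbols: one for each definition of a primitive recursive function. \<open>Cmp n f gs\<close> carries
  its arity \<open>n\<close> because \<open>gs\<close> may be empty; \<open>Rec f g\<close> recurses on its first argument. Arities are
  enforced by \<open>wf_prfun\<close> and \<open>wf_tm\<close>.
\<close>

datatype prfun = Zer | Scc | Prj nat nat | Cmp nat prfun "prfun list" | Rec prfun prfun

fun arity :: "prfun \<Rightarrow> nat" where
  "arity Zer = 0"
| "arity Scc = 1"
| "arity (Prj n i) = n"
| "arity (Cmp n f gs) = n"
| "arity (Rec f g) = Suc (arity f)"

fun wf_prfun :: "prfun \<Rightarrow> bool" where
  "wf_prfun Zer \<longleftrightarrow> True"
| "wf_prfun Scc \<longleftrightarrow> True"
| "wf_prfun (Prj n i) \<longleftrightarrow> i < n"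
| "wf_prfun (Cmp n f gs) \<longleftrightarrow>
     wf_prfun f \<and> length gs = arity f \<and> (\<forall>g\<in>set gs. wf_prfun g \<and> arity g = n)"
| "wf_prfun (Rec f g) \<longleftrightarrow> wf_prfun f \<and> wf_prfun g \<and> arity g = arity f + 2"

text \<open>Variables are de Bruijn indices; dangling indices are the free variables.\<close>

datatype tm = Var nat | App prfun "tm list"

fun wf_tm :: "tm \<Rightarrow> bool" where
  "wf_tm (Var n) \<longleftrightarrow> True"
| "wf_tm (App f ts) \<longleftrightarrow> wf_prfun f \<and> length ts = arity f \<and> (\<forall>t\<in>set ts. wf_tm t)"

abbreviation zero_tm :: tm where "zero_tm \<equiv> App Zer []"
abbreviation suc_tm :: "tm \<Rightarrow> tm" where "suc_tm t \<equiv> App Scc [t]"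

datatype fm =
    Bot
  | Star
  | Eq tm tm
  | And fm fm
  | Or fm fm
  | Imp fm fm
  | Forall fm
  | Exists fm

abbreviation Neg :: "fm \<Rightarrow> fm" where "Neg \<phi> \<equiv> Imp \<phi> Bot"

fun wf_fm :: "fm \<Rightarrow> bool" where
  "wf_fm Bot \<longleftrightarrow> True"
| "wf_fm Star \<longleftrightarrow> True"
| "wf_fm (Eq s t) \<longleftrightarrow> wf_tm s \<and> wf_tm t"
| "wf_fm (And \<phi> \<psi>) \<longleftrightarrow> wf_fm \<phi> \<and> wf_fm \<psi>"
| "wf_fm (Or \<phi> \<psi>) \<longleftrightarrow> wf_fm \<phi> \<and> wf_fm \<psi>"
| "wf_fm (Imp \<phi> \<psi>) \<longleftrightarrow> wf_fm \<phi> \<and> wf_fm \<psi>"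
| "wf_fm (Forall \<phi>) \<longleftrightarrow> wf_fm \<phi>"
| "wf_fm (Exists \<phi>) \<longleftrightarrow> wf_fm \<phi>"

fun star_free :: "fm \<Rightarrow> bool" where
  "star_free Bot \<longleftrightarrow> True"
| "star_free Star \<longleftrightarrow> False"
| "star_free (Eq s t) \<longleftrightarrow> True"
| "star_free (And \<phi> \<psi>) \<longleftrightarrow> star_free \<phi> \<and> star_free \<psi>"
| "star_free (Or \<phi> \<psi>) \<longleftrightarrow> star_free \<phi> \<and> star_free \<psi>"
| "star_free (Imp \<phi> \<psi>) \<longleftrightarrow> star_free \<phi> \<and> star_free \<psi>"
| "star_free (Forall \<phi>) \<longleftrightarrow> star_free \<phi>"
| "star_free (Exists \<phi>) \<longleftrightarrow> star_free \<phi>"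

definition lang_HA :: "fm set" where
  "lang_HA = {\<phi>. wf_fm \<phi> \<and> star_free \<phi>}"

definition lang_HA_star :: "fm set" where
  "lang_HA_star = {\<phi>. wf_fm \<phi>}"

text \<open>Simultaneous capture-avoiding substitution.\<close>

fun subst_tm :: "(nat \<Rightarrow> tm) \<Rightarrow> tm \<Rightarrow> tm" where
  "subst_tm \<sigma> (Var n) = \<sigma> n"
| "subst_tm \<sigma> (App f ts) = App f (map (subst_tm \<sigma>) ts)"

definition up :: "(nat \<Rightarrow> tm) \<Rightarrow> nat \<Rightarrow> tm" where
  "up \<sigma> = case_nat (Var 0) (\<lambda>n. subst_tm (\<lambda>i. Var (Suc i)) (\<sigma> n))"

fun subst :: "(nat \<Rightarrow> tm) \<Rightarrow> fm \<Rightarrow> fm" where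
  "subst \<sigma> Bot = Bot"
| "subst \<sigma> Star = Star"
| "subst \<sigma> (Eq s t) = Eq (subst_tm \<sigma> s) (subst_tm \<sigma> t)"
| "subst \<sigma> (And \<phi> \<psi>) = And (subst \<sigma> \<phi>) (subst \<sigma> \<psi>)"
| "subst \<sigma> (Or \<phi> \<psi>) = Or (subst \<sigma> \<phi>) (subst \<sigma> \<psi>)"
| "subst \<sigma> (Imp \<phi> \<psi>) = Imp (subst \<sigma> \<phi>) (subst \<sigma> \<psi>)"
| "subst \<sigma> (Forall \<phi>) = Forall (subst (up \<sigma>) \<phi>)"
| "subst \<sigma> (Exists \<phi>) = Exists (subst (up \<sigma>) \<phi>)"

definition lift :: "fm \<Rightarrow> fm" where
  "lift \<phi> = subst (\<lambda>n. Var (Suc n)) \<phi>"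

text \<open>\<open>inst \<phi> t\<close> removes the binder of variable 0 of \<open>\<phi>\<close>, replacing the variable by \<open>t\<close>;
  \<open>inst_suc \<phi>\<close> replaces variable 0 by its successor and leaves all other variables alone.\<close>

definition inst :: "fm \<Rightarrow> tm \<Rightarrow> fm" where
  "inst \<phi> t = subst (case_nat t Var) \<phi>"

definition inst_suc :: "fm \<Rightarrow> fm" where
  "inst_suc \<phi> = subst (case_nat (suc_tm (Var 0)) (\<lambda>n. Var (Suc n))) \<phi>"

text \<open>
  Intuitionistic natural deduction in the language \<open>L\<close>: every formula of a derivation lies in \<open>L\<close>.
  The elements of \<open>Ax\<close> are non-logical axioms, available in every context, so that their free
  variables are implicitly universally quantified; the free variables of the context \<open>\<Gamma>\<close> are fixed.
\<close>

inductive derives :: "fm set \<Rightarrow> fm set \<Rightarrow> fm list \<Rightarrow> fm \<Rightarrow> bool" for L Ax where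
  Axiom: "\<phi> \<in> Ax \<Longrightarrow> \<phi> \<in> L \<Longrightarrow> set \<Gamma> \<subseteq> L \<Longrightarrow> derives L Ax \<Gamma> \<phi>"
| Assm: "\<phi> \<in> set \<Gamma> \<Longrightarrow> set \<Gamma> \<subseteq> L \<Longrightarrow> derives L Ax \<Gamma> \<phi>"
| BotE: "derives L Ax \<Gamma> Bot \<Longrightarrow> \<phi> \<in> L \<Longrightarrow> derives L Ax \<Gamma> \<phi>"
| AndI: "derives L Ax \<Gamma> \<phi> \<Longrightarrow> derives L Ax \<Gamma> \<psi> \<Longrightarrow> derives L Ax \<Gamma> (And \<phi> \<psi>)"
| AndE1: "derives L Ax \<Gamma> (And \<phi> \<psi>) \<Longrightarrow> derives L Ax \<Gamma> \<phi>"
| AndE2: "derives L Ax \<Gamma> (And \<phi> \<psi>) \<Longrightarrow> derives L Ax \<Gamma> \<psi>"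
| OrI1: "derives L Ax \<Gamma> \<phi> \<Longrightarrow> \<psi> \<in> L \<Longrightarrow> derives L Ax \<Gamma> (Or \<phi> \<psi>)"
| OrI2: "derives L Ax \<Gamma> \<psi> \<Longrightarrow> \<phi> \<in> L \<Longrightarrow> derives L Ax \<Gamma> (Or \<phi> \<psi>)"
| OrE: "derives L Ax \<Gamma> (Or \<phi> \<psi>) \<Longrightarrow> derives L Ax (\<phi> # \<Gamma>) \<chi> \<Longrightarrow> derives L Ax (\<psi> # \<Gamma>) \<chi> \<Longrightarrow>
    derives L Ax \<Gamma> \<chi>"
| ImpI: "derives L Ax (\<phi> # \<Gamma>) \<psi> \<Longrightarrow> derives L Ax \<Gamma> (Imp \<phi> \<psi>)"
| ImpE: "derives L Ax \<Gamma> (Imp \<phi> \<psi>) \<Longrightarrow> derives L Ax \<Gamma> \<phi> \<Longrightarrow> derives L Ax \<Gamma> \<psi>"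
| AllI: "derives L Ax (map lift \<Gamma>) \<phi> \<Longrightarrow> derives L Ax \<Gamma> (Forall \<phi>)"
| AllE: "derives L Ax \<Gamma> (Forall \<phi>) \<Longrightarrow> wf_tm t \<Longrightarrow> derives L Ax \<Gamma> (inst \<phi> t)"
| ExI: "derives L Ax \<Gamma> (inst \<phi> t) \<Longrightarrow> wf_tm t \<Longrightarrow> Exists \<phi> \<in> L \<Longrightarrow> derives L Ax \<Gamma> (Exists \<phi>)"
| ExE: "derives L Ax \<Gamma> (Exists \<phi>) \<Longrightarrow> derives L Ax (\<phi> # map lift \<Gamma>) (lift \<psi>) \<Longrightarrow>
    derives L Ax \<Gamma> \<psi>"

text \<open>Axioms of arithmetic, with the schemes (Leibniz, induction) ranging over the language \<open>L\<close>.\<close>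

inductive_set arith_axioms :: "fm set \<Rightarrow> fm set" for L where
  Refl: "wf_tm t \<Longrightarrow> Eq t t \<in> arith_axioms L"
| Leibniz: "\<phi> \<in> L \<Longrightarrow> wf_tm s \<Longrightarrow> wf_tm t \<Longrightarrow>
    Imp (Eq s t) (Imp (inst \<phi> s) (inst \<phi> t)) \<in> arith_axioms L"
| Suc_not_zero: "wf_tm t \<Longrightarrow> Neg (Eq (suc_tm t) zero_tm) \<in> arith_axioms L"
| Suc_inj: "wf_tm s \<Longrightarrow> wf_tm t \<Longrightarrow> Imp (Eq (suc_tm s) (suc_tm t)) (Eq s t) \<in> arith_axioms L"
| Prj_eq: "wf_tm (App (Prj n i) ts) \<Longrightarrow> Eq (App (Prj n i) ts) (ts ! i) \<in> arith_axioms L"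
| Cmp_eq: "wf_tm (App (Cmp n f gs) ts) \<Longrightarrow>
    Eq (App (Cmp n f gs) ts) (App f (map (\<lambda>g. App g ts) gs)) \<in> arith_axioms L"
| Rec_zero_eq: "wf_tm (App (Rec f g) (zero_tm # ts)) \<Longrightarrow>
    Eq (App (Rec f g) (zero_tm # ts)) (App f ts) \<in> arith_axioms L"
| Rec_suc_eq: "wf_tm (App (Rec f g) (suc_tm t # ts)) \<Longrightarrow>
    Eq (App (Rec f g) (suc_tm t # ts)) (App g (t # App (Rec f g) (t # ts) # ts)) \<in> arith_axioms L"
| Induct: "\<phi> \<in> L \<Longrightarrow>
    Imp (inst \<phi> zero_tm) (Imp (Forall (Imp \<phi> (inst_suc \<phi>))) (Forall \<phi>)) \<in> arith_axioms L"

fun qfree :: "fm \<Rightarrow> bool" where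
  "qfree Bot \<longleftrightarrow> True"
| "qfree Star \<longleftrightarrow> True"
| "qfree (Eq s t) \<longleftrightarrow> True"
| "qfree (And \<phi> \<psi>) \<longleftrightarrow> qfree \<phi> \<and> qfree \<psi>"
| "qfree (Or \<phi> \<psi>) \<longleftrightarrow> qfree \<phi> \<and> qfree \<psi>"
| "qfree (Imp \<phi> \<psi>) \<longleftrightarrow> qfree \<phi> \<and> qfree \<psi>"
| "qfree (Forall \<phi>) \<longleftrightarrow> False"
| "qfree (Exists \<phi>) \<longleftrightarrow> False"

text \<open>The classes \<open>\<Sigma>\<^sub>k\<close> and \<open>\<Pi>\<^sub>k\<close> of formulas of HA; quantifier blocks may be empty.\<close>

fun Sigma_fm :: "nat \<Rightarrow> fm set" and Pi_fm :: "nat \<Rightarrow> fm set" where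
  "Sigma_fm 0 = {\<phi> \<in> lang_HA. qfree \<phi>}"
| "Sigma_fm (Suc m) = {(Exists ^^ n) \<phi> | n \<phi>. \<phi> \<in> Pi_fm m}"
| "Pi_fm 0 = {\<phi> \<in> lang_HA. qfree \<phi>}"
| "Pi_fm (Suc m) = {(Forall ^^ n) \<phi> | n \<phi>. \<phi> \<in> Sigma_fm m}"

definition LEM :: "fm set \<Rightarrow> fm set" where
  "LEM C = {Or \<phi> (Neg \<phi>) | \<phi>. \<phi> \<in> C}"

definition HA_LEM_proves :: "nat \<Rightarrow> fm \<Rightarrow> bool" where
  "HA_LEM_proves k \<phi> \<longleftrightarrow>
     derives lang_HA (arith_axioms lang_HA \<union> LEM (Sigma_fm k)) [] \<phi>"

definition HA_star_LEM_proves :: "nat \<Rightarrow> fm \<Rightarrow> bool" where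
  "HA_star_LEM_proves k \<phi> \<longleftrightarrow>
     derives lang_HA_star (arith_axioms lang_HA_star \<union> LEM (Sigma_fm k)) [] \<phi>"

text \<open>The Friedman translation; it is only meant for formulas of HA, and the clause for \<open>Star\<close>
  merely makes the function total.\<close>

fun friedman :: "fm \<Rightarrow> fm" where
  "friedman Bot = Or Bot Star"
| "friedman Star = Or Star Star"
| "friedman (Eq s t) = Or (Eq s t) Star"
| "friedman (And \<phi> \<psi>) = And (friedman \<phi>) (friedman \<psi>)"
| "friedman (Or \<phi> \<psi>) = Or (friedman \<phi>) (friedman \<psi>)"
| "friedman (Imp \<phi> \<psi>) = Imp (friedman \<phi>) (friedman \<psi>)"
| "friedman (Forall \<phi>) = Forall (friedman \<phi>)"
| "friedman (Exists \<phi>) = Exists (friedman \<phi>)"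

end

theory Submission
  imports Defs
begin

text \<open>
  The translation is sound for intuitionistic logic and for the axioms of arithmetic because
  \<open>*\<close> implies every \<open>\<phi>\<^sup>*\<close>. For the instances of \<open>LEM(\<Sigma>\<^sub>k)\<close> one shows that
  \<open>\<phi>\<^sup>*\<close> is equivalent to \<open>\<phi> \<or> *\<close> for every \<open>\<phi>\<close> in \<open>\<Sigma>\<^sub>k\<close>; then \<open>\<phi> \<or> \<not> \<phi>\<close> yields
  \<open>\<phi>\<^sup>* \<or> (\<phi>\<^sup>* \<longrightarrow> \<bottom>\<^sup>*)\<close>. The critical step is \<open>\<forall>x. (\<phi> \<or> *)\<close> implies \<open>(\<forall>x. \<phi>) \<or> *\<close>: it uses
  that \<open>LEM(\<Sigma>\<^sub>k)\<close> provides, for each \<open>\<Pi>\<^sub>k\<close> formula, a \<open>\<Sigma>\<^sub>k\<close> formula equivalent to its negation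
  (and vice versa), so that either \<open>\<forall>x. \<phi>\<close> holds or some \<open>x\<close> refutes \<open>\<phi>\<close>.
\<close>

section \<open>Substitution\<close>

lemma subst_tm_comp: "subst_tm \<sigma> (subst_tm \<tau> t) = subst_tm (\<lambda>n. subst_tm \<sigma> (\<tau> n)) t"
  by (induction t) auto

lemma up_comp: "(\<lambda>n. subst_tm (up \<sigma>) (up \<tau> n)) = up (\<lambda>n. subst_tm \<sigma> (\<tau> n))"
  by (rule ext) (auto simp: up_def subst_tm_comp split: nat.split)

lemma subst_comp: "subst \<sigma> (subst \<tau> \<phi>) = subst (\<lambda>n. subst_tm \<sigma> (\<tau> n)) \<phi>"
  by (induction \<phi> arbitrary: \<sigma> \<tau>) (auto simp: subst_tm_comp up_comp)

lemma subst_tm_Var: "subst_tm Var t = t"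
  by (induction t) (auto simp: map_idI)

lemma up_Var: "up Var = Var"
  by (rule ext) (auto simp: up_def split: nat.split)

lemma subst_Var: "subst Var \<phi> = \<phi>"
  by (induction \<phi>) (auto simp: subst_tm_Var up_Var)

text \<open>The two substitutions compose to \<open>Var\<close>. This serves to open a lifted
  quantifier at the eigenvariable \<open>Var 0\<close> and get back its original matrix.\<close>

lemma inst_subst_up_shift: "inst (subst (up (\<lambda>n. Var (Suc n))) \<phi>) (Var 0) = \<phi>"
proof -
  have "(\<lambda>n. subst_tm (case_nat (Var 0) Var) (up (\<lambda>n. Var (Suc n)) n)) = Var"
    by (rule ext) (auto simp: up_def split: nat.split)
  then show ?thesis
    by (simp add: inst_def subst_comp subst_Var)
qed

section \<open>Well-formedness under substitution\<close>

lemma wf_subst_tm: "wf_tm t \<Longrightarrow> (\<And>n. wf_tm (\<sigma> n)) \<Longrightarrow> wf_tm (subst_tm \<sigma> t)"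
  by (induction t) auto

lemma wf_subst_tmD: "wf_tm (subst_tm \<sigma> t) \<Longrightarrow> wf_tm t"
  by (induction t) auto

lemma wf_up: "(\<And>n. wf_tm (\<sigma> n)) \<Longrightarrow> wf_tm (up \<sigma> n)"
  by (auto simp: up_def wf_subst_tm split: nat.split)

lemma wf_subst: "wf_fm \<phi> \<Longrightarrow> (\<And>n. wf_tm (\<sigma> n)) \<Longrightarrow> wf_fm (subst \<sigma> \<phi>)"
  by (induction \<phi> arbitrary: \<sigma>) (auto simp: wf_subst_tm wf_up)

text \<open>Substitution changes no function symbol and no number of arguments, so it cannot repair
  an ill-formed formula. Through \<open>wf_lift\<close>, this lets \<open>prv_wf\<close> pass from a
  lifted context back to the context itself.\<close>

lemma wf_substD: "wf_fm (subst \<sigma> \<phi>) \<Longrightarrow> wf_fm \<phi>"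
  by (induction \<phi> arbitrary: \<sigma>) (auto dest: wf_subst_tmD)

lemma wf_lift [simp]: "wf_fm (lift \<phi>) \<longleftrightarrow> wf_fm \<phi>"
  unfolding lift_def by (auto intro: wf_subst dest: wf_substD)

lemma wf_inst: "wf_fm \<phi> \<Longrightarrow> wf_tm t \<Longrightarrow> wf_fm (inst \<phi> t)"
  unfolding inst_def by (auto intro!: wf_subst split: nat.split)

lemma wf_instD: "wf_fm (inst \<phi> t) \<Longrightarrow> wf_fm \<phi>"
  unfolding inst_def by (rule wf_substD)

section \<open>The translation and substitution\<close>

lemma wf_friedman [simp]: "wf_fm (friedman \<phi>) \<longleftrightarrow> wf_fm \<phi>"
  by (induction \<phi>) auto

text \<open>The translation only adds \<open>Star\<close> to prime formulas, and \<open>Star\<close>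
  contains no variables. Hence quantifier rules and induction instances translate to quantifier
  rules and induction instances.\<close>

lemma friedman_subst: "friedman (subst \<sigma> \<phi>) = subst \<sigma> (friedman \<phi>)"
  by (induction \<phi> arbitrary: \<sigma>) auto

lemma friedman_lift: "friedman (lift \<phi>) = lift (friedman \<phi>)"
  by (simp add: lift_def friedman_subst)

lemma friedman_inst: "friedman (inst \<phi> t) = inst (friedman \<phi>) t"
  by (simp add: inst_def friedman_subst)

lemma friedman_inst_suc: "friedman (inst_suc \<phi>) = inst_suc (friedman \<phi>)"
  by (simp add: inst_suc_def friedman_subst)

lemma in_lang_HA_star [simp]: "\<phi> \<in> lang_HA_star \<longleftrightarrow> wf_fm \<phi>"
  by (simp add: lang_HA_star_def)

lemma subset_lang_HA_star [simp]: "A \<subseteq> lang_HA_star \<longleftrightarrow> (\<forall>\<phi>\<in>A. wf_fm \<phi>)"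
  by auto


section \<open>Derived rules\<close>

abbreviation prv :: "fm set \<Rightarrow> fm list \<Rightarrow> fm \<Rightarrow> bool" where
  "prv \<equiv> derives lang_HA_star"

lemma prv_wf: "prv Ax \<Gamma> \<phi> \<Longrightarrow> wf_fm \<phi> \<and> (\<forall>\<psi>\<in>set \<Gamma>. wf_fm \<psi>)"
  by (induction rule: derives.induct) (auto simp: wf_inst dest: wf_instD)

text \<open>Contexts are compared as sets, so exchange and contraction are included. The induction
  hypothesis must cover every \<open>\<Delta>\<close>, because some rules extend or lift the
  context.\<close>

lemma prv_weaken:
  "prv Ax \<Gamma> \<phi> \<Longrightarrow> set \<Gamma> \<subseteq> set \<Delta> \<Longrightarrow> \<forall>\<psi>\<in>set \<Delta>. wf_fm \<psi> \<Longrightarrow> prv Ax \<Delta> \<phi>"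
proof (induction arbitrary: \<Delta> rule: derives.induct)
  case (OrE \<Gamma> \<phi> \<psi> \<chi>)
  have "wf_fm \<phi>" "wf_fm \<psi>" using prv_wf[OF OrE.hyps(1)] by auto
  with OrE.prems show ?case
    by (intro derives.OrE[OF OrE.IH(1) OrE.IH(2) OrE.IH(3)]) auto
next
  case (ImpI \<phi> \<Gamma> \<psi>)
  have "wf_fm \<phi>" using prv_wf[OF ImpI.hyps(1)] by auto
  with ImpI.prems show ?case by (intro derives.ImpI ImpI.IH) auto
next
  case (AllI \<Gamma> \<phi>)
  then show ?case by (intro derives.AllI AllI.IH) auto
next
  case (ExE \<Gamma> \<phi> \<psi>)
  have "wf_fm \<phi>" using prv_wf[OF ExE.hyps(1)] by auto
  with ExE.prems show ?case
    by (intro derives.ExE[OF ExE.IH(1) ExE.IH(2)]) auto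
next
  case (ExI \<Gamma> \<phi> t)
  then show ?case by (intro derives.ExI[OF ExI.IH]) auto
qed (auto intro: derives.intros)

lemma prv_cut: "prv Ax \<Gamma> \<phi> \<Longrightarrow> prv Ax (\<phi> # \<Gamma>) \<psi> \<Longrightarrow> prv Ax \<Gamma> \<psi>"
  by (blast intro: derives.ImpI derives.ImpE)

lemma prv_trans: "prv Ax [\<phi>] \<psi> \<Longrightarrow> prv Ax \<Gamma> \<phi> \<Longrightarrow> prv Ax \<Gamma> \<psi>"
  by (rule prv_cut, assumption, rule prv_weaken) (auto dest: prv_wf)

lemma prv_theorem: "prv Ax [] \<phi> \<Longrightarrow> \<forall>\<psi>\<in>set \<Gamma>. wf_fm \<psi> \<Longrightarrow> prv Ax \<Gamma> \<phi>"
  by (rule prv_weaken) auto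

lemma prv_Assm [simp]: "\<phi> \<in> set \<Gamma> \<Longrightarrow> \<forall>\<psi>\<in>set \<Gamma>. wf_fm \<psi> \<Longrightarrow> prv Ax \<Gamma> \<phi>"
  by (rule derives.Assm) auto

text \<open>Once a binder has been entered, variable 0 is the eigenvariable. Instantiating the
  lifted universal formula at it yields the matrix unchanged.\<close>

lemma prv_lifted_AllE:
  assumes "lift (Forall \<phi>) \<in> set \<Gamma>" "\<forall>\<psi>\<in>set \<Gamma>. wf_fm \<psi>"
  shows "prv Ax \<Gamma> \<phi>"
proof -
  have "prv Ax \<Gamma> (Forall (subst (up (\<lambda>n. Var (Suc n))) \<phi>))"
    using assms by (intro prv_Assm) (auto simp: lift_def)
  from derives.AllE[OF this, of "Var 0"] show ?thesis
    by (simp add: inst_subst_up_shift)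
qed

text \<open>The counterpart for the existential quantifier: the eigenvariable \<open>Var 0\<close>
  is the witness.\<close>

lemma prv_lifted_ExI:
  assumes "prv Ax \<Gamma> \<phi>"
  shows "prv Ax \<Gamma> (lift (Exists \<phi>))"
proof -
  have "wf_fm (lift (Exists \<phi>))" using prv_wf[OF assms] by simp
  then have "wf_fm (Exists (subst (up (\<lambda>n. Var (Suc n))) \<phi>))" by (simp add: lift_def)
  then show ?thesis
    using derives.ExI[of lang_HA_star Ax \<Gamma> "subst (up (\<lambda>n. Var (Suc n))) \<phi>" "Var 0"] assms
    by (simp add: inst_subst_up_shift lift_def)
qed


section \<open>Soundness of the translation\<close>

text \<open>The generalisation over \<open>\<sigma>\<close> lets the existential case apply the induction hypothesis to an
  instance of the matrix.\<close>

lemma prv_friedman_subst_if_Star_assm: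
  assumes "Star \<in> set \<Gamma>" "\<forall>\<psi>\<in>set \<Gamma>. wf_fm \<psi>" "wf_fm \<phi>" "\<And>n. wf_tm (\<sigma> n)"
  shows "prv Ax \<Gamma> (friedman (subst \<sigma> \<phi>))"
  using assms
proof (induction \<phi> arbitrary: \<Gamma> \<sigma>)
  case (Imp \<phi> \<psi>)
  then show ?case by (auto intro!: derives.ImpI simp: wf_subst)
next
  case (Forall \<phi>)
  \<comment> \<open>\<open>Star\<close> has no variables, so it survives the lifting of the
    context.\<close>
  have "Star \<in> set (map lift \<Gamma>)" using Forall.prems(1) by (force simp: lift_def)
  then have "prv Ax (map lift \<Gamma>) (friedman (subst (up \<sigma>) \<phi>))"
    using Forall.prems by (intro Forall.IH) (auto intro: wf_up)
  then show ?case by (auto intro: derives.AllI)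
next
  case (Exists \<phi>)
  \<comment> \<open>Zero is an arbitrary witness: under \<open>Star\<close> every instance of the
    translated matrix is derivable. \<open>?\<tau>\<close> merges instantiation at zero with
    \<open>up \<sigma>\<close>.\<close>
  let ?\<tau> = "\<lambda>n. subst_tm (case_nat zero_tm Var) (up \<sigma> n)"
  have "wf_tm (?\<tau> n)" for n
    using Exists.prems by (auto intro!: wf_subst_tm wf_up split: nat.split)
  then have "prv Ax \<Gamma> (friedman (subst ?\<tau> \<phi>))"
    using Exists by auto
  then have "prv Ax \<Gamma> (inst (friedman (subst (up \<sigma>) \<phi>)) zero_tm)"
    by (simp add: inst_def subst_comp flip: friedman_subst)
  then show ?case
    using Exists.prems by (auto intro!: derives.ExI[where t = zero_tm] wf_subst wf_up)
qed (auto intro!: derives.AndI intro: derives.OrI1 derives.OrI2 derives.Assm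
    simp: wf_subst_tm wf_subst)

lemma prv_friedman_if_Star:
  assumes "prv Ax \<Gamma> Star" "wf_fm \<phi>"
  shows "prv Ax \<Gamma> (friedman \<phi>)"
  using prv_friedman_subst_if_Star_assm[of "[Star]" \<phi> Var Ax] assms
  by (auto simp: subst_Var intro: prv_trans)

text \<open>\<open>Star\<close> acts as falsity on translated formulas, so the second disjunct
  closes any translated goal. A translated prime hypothesis can thus be used as if it were the prime
  formula itself.\<close>

lemma prv_Or_Star_E:
  assumes "prv Ax \<Gamma> (Or \<phi> Star)" "prv Ax (\<phi> # \<Gamma>) (friedman \<psi>)"
  shows "prv Ax \<Gamma> (friedman \<psi>)"
proof (rule derives.OrE[OF assms])
  have "wf_fm \<psi>" "\<forall>\<psi>\<in>set \<Gamma>. wf_fm \<psi>" using prv_wf[OF assms(2)] by auto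
  then show "prv Ax (Star # \<Gamma>) (friedman \<psi>)"
    by (auto intro!: prv_friedman_if_Star)
qed

text \<open>Equations are weakened by the disjunct \<open>Star\<close>; for the Leibniz and
  successor axioms \<open>Star\<close> is first stripped from the antecedent. Translated induction
  is again induction, now for \<open>friedman \<psi>\<close>, so the schemes must range over the
  extended language.\<close>

lemma prv_friedman_arith_axiom:
  assumes "\<phi> \<in> arith_axioms lang_HA" "wf_fm \<phi>"
    and Ax: "arith_axioms lang_HA_star \<subseteq> Ax"
  shows "prv Ax [] (friedman \<phi>)"
proof -
  have ax: "prv Ax \<Gamma> \<psi>"
    if "\<psi> \<in> arith_axioms lang_HA_star" "wf_fm \<psi>" "\<forall>\<psi>\<in>set \<Gamma>. wf_fm \<psi>" for \<psi> \<Gamma>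
    using that Ax by (auto intro: derives.Axiom)
  have eq: "prv Ax [] (Or (Eq s t) Star)"
    if "Eq s t \<in> arith_axioms lang_HA_star" "wf_fm (Eq s t)" for s t
    using ax[OF that] by (auto intro: derives.OrI1)
  from assms(1,2) show ?thesis
  proof cases
    case (Leibniz \<psi> s t)
    then have wf: "wf_fm \<psi>" by (simp add: lang_HA_def)
    \<comment> \<open>This is Leibniz for \<open>friedman \<psi>\<close> with the bare equation as
      antecedent; \<open>prv_Or_Star_E\<close> then replaces that equation by its
      translation.\<close>
    let ?L = "Imp (Eq s t) (Imp (friedman (inst \<psi> s)) (friedman (inst \<psi> t)))"
    let ?G = "[Eq s t, friedman (inst \<psi> s), Or (Eq s t) Star]"
    have wfG: "\<forall>\<chi>\<in>set ?G. wf_fm \<chi>" using Leibniz wf by (auto simp: wf_inst)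
    have "?L \<in> arith_axioms lang_HA_star"
      using Leibniz wf by (auto simp: friedman_inst intro!: arith_axioms.Leibniz)
    then have "prv Ax ?G ?L"
      using wfG Leibniz wf by (intro ax) (auto simp: wf_inst)
    then have "prv Ax ?G (friedman (inst \<psi> t))"
      by (rule derives.ImpE[OF derives.ImpE]) (use wfG in auto)
    then have "prv Ax [friedman (inst \<psi> s), Or (Eq s t) Star] (friedman (inst \<psi> t))"
      by (rule prv_Or_Star_E[rotated]) (use wfG in auto)
    then show ?thesis using Leibniz by (auto intro!: derives.ImpI)
  next
    case (Suc_not_zero t)
    let ?E = "Eq (suc_tm t) zero_tm"
    have "prv Ax [?E, Or ?E Star] Bot"
      by (rule derives.ImpE[OF ax[of "Neg ?E"] prv_Assm])
        (use Suc_not_zero in \<open>auto intro: arith_axioms.Suc_not_zero\<close>)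
    then have "prv Ax [?E, Or ?E Star] (friedman Bot)"
      by (auto intro: derives.OrI1)
    then have "prv Ax [Or ?E Star] (friedman Bot)"
      by (rule prv_Or_Star_E[rotated]) (use Suc_not_zero in auto)
    then show ?thesis using Suc_not_zero by (auto intro!: derives.ImpI)
  next
    case (Suc_inj s t)
    let ?E = "Eq (suc_tm s) (suc_tm t)"
    have "prv Ax [?E, Or ?E Star] (Eq s t)"
      by (rule derives.ImpE[OF ax[of "Imp ?E (Eq s t)"] prv_Assm])
        (use Suc_inj in \<open>auto intro: arith_axioms.Suc_inj\<close>)
    then have "prv Ax [?E, Or ?E Star] (friedman (Eq s t))"
      by (auto intro: derives.OrI1)
    then have "prv Ax [Or ?E Star] (friedman (Eq s t))"
      by (rule prv_Or_Star_E[rotated]) (use Suc_inj in auto)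
    then show ?thesis using Suc_inj by (auto intro!: derives.ImpI)
  next
    case (Induct \<psi>)
    then have "wf_fm \<psi>" by (simp add: lang_HA_def)
    moreover from this have "friedman \<phi> \<in> arith_axioms lang_HA_star"
      using arith_axioms.Induct[of "friedman \<psi>" lang_HA_star] Induct
      by (simp add: friedman_inst friedman_inst_suc)
    ultimately show ?thesis using assms(2) by (intro ax) auto
  qed (auto intro!: eq arith_axioms.intros)
qed

text \<open>Each rule translates to itself, except that \<open>BotE\<close> starts from
  \<open>Or Bot Star\<close> and closes the second case by ex falso from \<open>Star\<close>. What
  remains of the theorem is to derive the translated axioms.\<close>

lemma derives_friedman:
  assumes "derives lang_HA Ax \<Gamma> \<phi>"
    and ax: "\<And>\<psi>. \<psi> \<in> Ax \<Longrightarrow> \<psi> \<in> lang_HA \<Longrightarrow> prv Ax' [] (friedman \<psi>)"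
  shows "prv Ax' (map friedman \<Gamma>) (friedman \<phi>)"
  using assms(1)
proof (induction rule: derives.induct)
  case (Axiom \<phi> \<Gamma>)
  then show ?case by (auto intro!: prv_theorem ax simp: lang_HA_def subset_iff)
next
  case (Assm \<phi> \<Gamma>)
  then show ?case by (intro prv_Assm) (auto simp: lang_HA_def)
next
  case (BotE \<Gamma> \<phi>)
  have wf: "\<forall>\<psi>\<in>set (map friedman \<Gamma>). wf_fm \<psi>" using prv_wf[OF BotE.IH] by blast
  show ?case
  proof (rule prv_Or_Star_E)
    show "prv Ax' (map friedman \<Gamma>) (Or Bot Star)" using BotE.IH by simp
    have "prv Ax' (Bot # map friedman \<Gamma>) Bot" using wf by auto
    then show "prv Ax' (Bot # map friedman \<Gamma>) (friedman \<phi>)"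
      by (rule derives.BotE) (use BotE.hyps in \<open>simp add: lang_HA_def\<close>)
  qed
next
  case (OrE \<Gamma> \<phi> \<psi> \<chi>)
  then show ?case by (auto intro: derives.OrE)
next
  case (AllI \<Gamma> \<phi>)
  then have "prv Ax' (map lift (map friedman \<Gamma>)) (friedman \<phi>)"
    by (simp add: comp_def friedman_lift)
  then show ?case by (auto intro!: derives.AllI)
next
  case (AllE \<Gamma> \<phi> t)
  then show ?case by (auto simp: friedman_inst intro: derives.AllE)
next
  case (ExI \<Gamma> \<phi> t)
  then show ?case by (auto simp: friedman_inst lang_HA_def intro: derives.ExI)
next
  case (ExE \<Gamma> \<phi> \<psi>)
  then have "prv Ax' (friedman \<phi> # map lift (map friedman \<Gamma>)) (lift (friedman \<psi>))"
    by (simp add: comp_def friedman_lift)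
  with ExE.IH(1) show ?case by (auto intro: derives.ExE)
next
  case (ImpE \<Gamma> \<phi> \<psi>)
  then show ?case by (auto intro: derives.ImpE)
qed (auto intro: derives.AndI derives.AndE1 derives.AndE2 derives.OrI1 derives.OrI2 derives.ImpI
    simp: lang_HA_def)


section \<open>Complements in the arithmetical hierarchy\<close>

lemma Sigma_Pi_wf: "(\<forall>\<phi>\<in>Sigma_fm m. wf_fm \<phi>) \<and> (\<forall>\<phi>\<in>Pi_fm m. wf_fm \<phi>)"
proof (induction m)
  case (Suc m)
  have "wf_fm ((Exists ^^ n) \<psi>) = wf_fm \<psi>" "wf_fm ((Forall ^^ n) \<psi>) = wf_fm \<psi>" for n \<psi>
    by (induction n) auto
  with Suc show ?case by auto
qed (auto simp: lang_HA_def)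

lemma prv_LEM_Sigma:
  assumes "\<phi> \<in> Sigma_fm m" "LEM (Sigma_fm m) \<subseteq> Ax"
  shows "prv Ax [] (Or \<phi> (Neg \<phi>))"
proof (rule derives.Axiom)
  show "Or \<phi> (Neg \<phi>) \<in> Ax" using assms unfolding LEM_def by blast
qed (use assms Sigma_Pi_wf in auto)

text \<open>The classes at level 0 coincide and blocks may be empty; afterwards the matrix moves up
  by the induction hypothesis. So excluded middle at one level includes all lower levels.\<close>

lemma Sigma_Pi_subset_Suc: "Sigma_fm m \<subseteq> Sigma_fm (Suc m) \<and> Pi_fm m \<subseteq> Pi_fm (Suc m)"
proof (induction m)
  case 0
  have "\<phi> = (Exists ^^ 0) \<phi>" "\<phi> = (Forall ^^ 0) \<phi>" for \<phi> by simp_all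
  then show ?case by (fastforce intro: exI[of _ 0])
next
  case (Suc m)
  then show ?case by (subst Sigma_fm.simps(2), subst Pi_fm.simps(2)) fastforce
qed

lemma LEM_Sigma_subset_Suc: "LEM (Sigma_fm m) \<subseteq> LEM (Sigma_fm (Suc m))"
  using Sigma_Pi_subset_Suc unfolding LEM_def by blast

text \<open>A symmetric strengthening of "\<open>\<psi>\<close> is the negation of
  \<open>\<phi>\<close>": it also makes both formulas decidable. Both derivations may contain free
  variables, so they can be used under a binder.\<close>

definition complementary :: "fm set \<Rightarrow> fm \<Rightarrow> fm \<Rightarrow> bool" where
  "complementary Ax \<phi> \<psi> \<longleftrightarrow> prv Ax [] (Or \<phi> \<psi>) \<and> prv Ax [\<phi>, \<psi>] Bot"

lemma complementary_wf: "complementary Ax \<phi> \<psi> \<Longrightarrow> wf_fm \<phi> \<and> wf_fm \<psi>"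
  by (auto simp: complementary_def dest: prv_wf)

lemma prv_cases:
  assumes "prv Ax [] (Or \<phi> \<psi>)" "prv Ax (\<phi> # \<Gamma>) \<chi>" "prv Ax (\<psi> # \<Gamma>) \<chi>"
  shows "prv Ax \<Gamma> \<chi>"
  using derives.OrE[OF prv_theorem[OF assms(1)] assms(2,3)] prv_wf[OF assms(2)] by auto

lemma complementary_sym:
  assumes "complementary Ax \<phi> \<psi>"
  shows "complementary Ax \<psi> \<phi>"
proof -
  note wf = complementary_wf[OF assms]
  have "prv Ax [] (Or \<psi> \<phi>)"
    using assms wf unfolding complementary_def
    by (auto elim!: prv_cases intro: derives.OrI1 derives.OrI2)
  moreover have "prv Ax [\<psi>, \<phi>] Bot"
    using assms wf unfolding complementary_def by (auto elim: prv_weaken)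
  ultimately show ?thesis by (simp add: complementary_def)
qed

lemma complementary_Neg:
  assumes "prv Ax [] (Or \<phi> (Neg \<phi>))"
  shows "complementary Ax \<phi> (Neg \<phi>)"
proof -
  have "wf_fm \<phi>" using prv_wf[OF assms] by simp
  then have "prv Ax [\<phi>, Neg \<phi>] Bot"
    by (intro derives.ImpE[OF prv_Assm prv_Assm, of \<phi>]) auto
  with assms show ?thesis by (simp add: complementary_def)
qed

text \<open>Decide \<open>Exists \<phi>\<close>. If it fails, then at each point
  \<open>\<phi>\<close> would provide a witness, so the other alternative \<open>\<psi>\<close>
  holds there. Conversely, a witness of \<open>\<phi>\<close> clashes with \<open>\<psi>\<close> at
  that same point.\<close>

lemma complementary_Exists_Forall:
  assumes c: "complementary Ax \<phi> \<psi>" and lem: "prv Ax [] (Or (Exists \<phi>) (Neg (Exists \<phi>)))"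
  shows "complementary Ax (Exists \<phi>) (Forall \<psi>)"
proof -
  have wf [simp]: "wf_fm \<phi>" "wf_fm \<psi>" using complementary_wf[OF c] by auto
  let ?N = "lift (Neg (Exists \<phi>))"
  have N: "?N = Imp (lift (Exists \<phi>)) Bot" by (simp add: lift_def)
  have "prv Ax [\<phi>, ?N] \<psi>"
  proof -
    have "prv Ax [\<phi>, ?N] (Imp (lift (Exists \<phi>)) Bot)"
      by (simp add: N)
    then have "prv Ax [\<phi>, ?N] Bot"
      by (rule derives.ImpE) (auto intro!: prv_lifted_ExI)
    then show ?thesis by (rule derives.BotE) simp
  qed
  moreover have "prv Ax [\<psi>, ?N] \<psi>" by (rule prv_Assm) auto
  ultimately have "prv Ax [?N] \<psi>"
    using c unfolding complementary_def by (blast intro: prv_cases)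
  then have "prv Ax [Neg (Exists \<phi>)] (Forall \<psi>)" by (auto intro: derives.AllI)
  then have "prv Ax [] (Or (Exists \<phi>) (Forall \<psi>))"
    by (rule prv_cases[OF lem derives.OrI1 derives.OrI2, rotated 2]) auto
  moreover have "prv Ax [Exists \<phi>, Forall \<psi>] Bot"
  proof (rule derives.ExE)
    show "prv Ax [Exists \<phi>, Forall \<psi>] (Exists \<phi>)" by (rule prv_Assm) auto
    let ?G = "\<phi> # map lift [Exists \<phi>, Forall \<psi>]"
    have "prv Ax ?G \<psi>" by (rule prv_lifted_AllE) auto
    moreover have "prv Ax (\<psi> # ?G) Bot"
      using c unfolding complementary_def by (auto elim!: prv_weaken)
    ultimately show "prv Ax ?G (lift Bot)"
      unfolding lift_def subst.simps(1) by (rule prv_cut)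
  qed
  ultimately show ?thesis by (simp add: complementary_def)
qed

text \<open>Quantifiers are added one at a time from the inside. Each intermediate existential
  formula is still \<open>\<Sigma>\<close> at level \<open>Suc m\<close>, so the available excluded
  middle decides it.\<close>

lemma complementary_blocks:
  assumes "complementary Ax \<phi> \<psi>" "\<phi> \<in> Pi_fm m" "LEM (Sigma_fm (Suc m)) \<subseteq> Ax"
  shows "complementary Ax ((Exists ^^ n) \<phi>) ((Forall ^^ n) \<psi>)"
proof (induction n)
  case 0
  with assms(1) show ?case by simp
next
  case (Suc n)
  have "(Exists ^^ Suc n) \<phi> \<in> Sigma_fm (Suc m)"
    using assms(2) unfolding Sigma_fm.simps by blast
  from complementary_Exists_Forall[OF Suc] prv_LEM_Sigma[OF this assms(3)]
  show ?case by simp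
qed

text \<open>Negation is pushed through the blocks by exchanging the quantifiers. By symmetry of
  \<open>complementary\<close>, excluded middle for \<Sigma> formulas also serves the \<Pi>
  formulas.\<close>

lemma ex_complementary:
  assumes "LEM (Sigma_fm m) \<subseteq> Ax"
  shows "(\<forall>\<phi>\<in>Sigma_fm m. \<exists>\<psi>\<in>Pi_fm m. complementary Ax \<phi> \<psi>) \<and>
    (\<forall>\<phi>\<in>Pi_fm m. \<exists>\<psi>\<in>Sigma_fm m. complementary Ax \<phi> \<psi>)"
  using assms
proof (induction m)
  case 0
  have "\<forall>\<phi>\<in>Sigma_fm 0. \<exists>\<psi>\<in>Sigma_fm 0. complementary Ax \<phi> \<psi>"
  proof
    fix \<phi> assume \<phi>: "\<phi> \<in> Sigma_fm 0"
    \<comment> \<open>At level 0 the negation itself stays in the class, and \<Sigma> and \<Pi>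
      agree.\<close>
    then have "Neg \<phi> \<in> Sigma_fm 0" by (simp add: lang_HA_def)
    with complementary_Neg[OF prv_LEM_Sigma[OF \<phi> 0]]
    show "\<exists>\<psi>\<in>Sigma_fm 0. complementary Ax \<phi> \<psi>" by blast
  qed
  then show ?case by simp
next
  case (Suc m)
  have IH: "\<forall>\<phi>\<in>Sigma_fm m. \<exists>\<psi>\<in>Pi_fm m. complementary Ax \<phi> \<psi>"
    "\<forall>\<phi>\<in>Pi_fm m. \<exists>\<psi>\<in>Sigma_fm m. complementary Ax \<phi> \<psi>"
    using Suc.IH Suc.prems LEM_Sigma_subset_Suc[of m] by auto
  note block = complementary_blocks[OF _ _ Suc.prems]
  show ?case
  proof (intro conjI ballI)
    fix \<phi> assume "\<phi> \<in> Sigma_fm (Suc m)"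
    then obtain n \<chi> where \<chi>: "\<phi> = (Exists ^^ n) \<chi>" "\<chi> \<in> Pi_fm m" by auto
    with IH obtain \<chi>' where "\<chi>' \<in> Sigma_fm m" "complementary Ax \<chi> \<chi>'" by blast
    with \<chi> block show "\<exists>\<psi>\<in>Pi_fm (Suc m). complementary Ax \<phi> \<psi>" by auto
  next
    fix \<phi> assume "\<phi> \<in> Pi_fm (Suc m)"
    then obtain n \<chi> where \<chi>: "\<phi> = (Forall ^^ n) \<chi>" "\<chi> \<in> Sigma_fm m" by auto
    \<comment> \<open>The complement is put first because \<open>complementary_blocks\<close>
      attaches the existential block to the first formula.\<close>
    with IH obtain \<chi>' where "\<chi>' \<in> Pi_fm m" "complementary Ax \<chi>' \<chi>"
      using complementary_sym by blast
    with \<chi> block have "complementary Ax \<phi> ((Exists ^^ n) \<chi>')"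
      and "(Exists ^^ n) \<chi>' \<in> Sigma_fm (Suc m)"
      by (auto intro: complementary_sym)
    then show "\<exists>\<psi>\<in>Sigma_fm (Suc m). complementary Ax \<phi> \<psi>" by blast
  qed
qed


section \<open>The translation on the arithmetical hierarchy\<close>

text \<open>This expresses that \<open>friedman \<phi>\<close> is equivalent to
  \<open>Or \<phi> Star\<close>. The remaining implication, from \<open>Star\<close> to
  \<open>friedman \<phi>\<close>, is \<open>prv_friedman_if_Star\<close>.\<close>

definition friedman_Or_Star :: "fm set \<Rightarrow> fm \<Rightarrow> bool" where
  "friedman_Or_Star Ax \<phi> \<longleftrightarrow>
     prv Ax [\<phi>] (friedman \<phi>) \<and> prv Ax [friedman \<phi>] (Or \<phi> Star)"

lemma friedman_Or_StarD:
  assumes "friedman_Or_Star Ax \<phi>"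
  shows "prv Ax \<Gamma> \<phi> \<Longrightarrow> prv Ax \<Gamma> (friedman \<phi>)"
    and "prv Ax \<Gamma> (friedman \<phi>) \<Longrightarrow> prv Ax \<Gamma> (Or \<phi> Star)"
  using assms by (auto simp: friedman_Or_Star_def intro: prv_trans)

lemma friedman_Or_Star_wf: "friedman_Or_Star Ax \<phi> \<Longrightarrow> wf_fm \<phi>"
  by (auto simp: friedman_Or_Star_def dest: prv_wf)

section \<open>Closure under connectives and quantifiers\<close>

lemma friedman_Or_Star_prime:
  assumes "wf_fm \<phi>" "friedman \<phi> = Or \<phi> Star"
  shows "friedman_Or_Star Ax \<phi>"
  using assms by (auto simp: friedman_Or_Star_def intro!: derives.OrI1)

lemma friedman_Or_Star_And:
  assumes \<phi>: "friedman_Or_Star Ax \<phi>" and \<psi>: "friedman_Or_Star Ax \<psi>"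
  shows "friedman_Or_Star Ax (And \<phi> \<psi>)"
proof -
  have [simp]: "wf_fm \<phi>" "wf_fm \<psi>" using assms by (auto dest: friedman_Or_Star_wf)
  have "prv Ax [And \<phi> \<psi>] (And \<phi> \<psi>)" by (rule prv_Assm) auto
  then have "prv Ax [And \<phi> \<psi>] (friedman (And \<phi> \<psi>))"
    using friedman_Or_StarD(1)[OF \<phi> derives.AndE1] friedman_Or_StarD(1)[OF \<psi> derives.AndE2]
    unfolding friedman.simps by (blast intro: derives.AndI)
  moreover
  let ?F = "And (friedman \<phi>) (friedman \<psi>)"
  have F: "prv Ax [?F] ?F" by (rule prv_Assm) auto
  have 1: "prv Ax [?F] (Or \<phi> Star)"
    by (rule friedman_Or_StarD(2)[OF \<phi> derives.AndE1[OF F]])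
  have 2: "prv Ax [\<phi>, ?F] (Or \<psi> Star)"
    by (rule prv_weaken[OF friedman_Or_StarD(2)[OF \<psi> derives.AndE2[OF F]]]) auto
  have "prv Ax [?F] (Or (And \<phi> \<psi>) Star)"
  proof (rule derives.OrE[OF 1 derives.OrE[OF 2]])
    show "prv Ax [\<psi>, \<phi>, ?F] (Or (And \<phi> \<psi>) Star)"
      by (auto intro!: derives.OrI1 derives.AndI)
  qed (auto intro!: derives.OrI2)
  ultimately show ?thesis by (simp add: friedman_Or_Star_def)
qed

lemma friedman_Or_Star_Or:
  assumes \<phi>: "friedman_Or_Star Ax \<phi>" and \<psi>: "friedman_Or_Star Ax \<psi>"
  shows "friedman_Or_Star Ax (Or \<phi> \<psi>)"
proof -
  have [simp]: "wf_fm \<phi>" "wf_fm \<psi>" using assms by (auto dest: friedman_Or_Star_wf)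
  have "prv Ax [Or \<phi> \<psi>] (friedman (Or \<phi> \<psi>))"
    by (rule derives.OrE[of _ _ _ \<phi> \<psi>])
      (auto intro: derives.OrI1[OF friedman_Or_StarD(1)[OF \<phi>]]
        derives.OrI2[OF friedman_Or_StarD(1)[OF \<psi>]])
  moreover
  let ?F = "Or (friedman \<phi>) (friedman \<psi>)"
  have "prv Ax [?F] (Or (Or \<phi> \<psi>) Star)"
  proof (rule derives.OrE)
    show "prv Ax [?F] (Or (friedman \<phi>) (friedman \<psi>))" by simp
    show "prv Ax [friedman \<phi>, ?F] (Or (Or \<phi> \<psi>) Star)"
      by (rule derives.OrE[OF friedman_Or_StarD(2)[OF \<phi>]])
        (auto intro: derives.OrI1[OF derives.OrI1] derives.OrI2)
    show "prv Ax [friedman \<psi>, ?F] (Or (Or \<phi> \<psi>) Star)"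
      by (rule derives.OrE[OF friedman_Or_StarD(2)[OF \<psi>]])
        (auto intro: derives.OrI1[OF derives.OrI2] derives.OrI2)
  qed
  ultimately show ?thesis by (simp add: friedman_Or_Star_def)
qed

text \<open>To extract \<open>Or (Imp \<phi> \<psi>) Star\<close>, a disjunct has to be chosen
  before \<open>\<phi>\<close> is assumed, so \<open>\<phi>\<close> is decided first. If it holds,
  the translated implication gives \<open>\<psi>\<close> or \<open>Star\<close>; if it fails, the
  implication is vacuous.\<close>

lemma friedman_Or_Star_Imp:
  assumes \<phi>: "friedman_Or_Star Ax \<phi>" and \<psi>: "friedman_Or_Star Ax \<psi>"
    and lem: "prv Ax [] (Or \<phi> (Neg \<phi>))"
  shows "friedman_Or_Star Ax (Imp \<phi> \<psi>)"
proof -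
  have [simp]: "wf_fm \<phi>" "wf_fm \<psi>" using assms by (auto dest: friedman_Or_Star_wf)
  have "prv Ax [friedman \<phi>, Imp \<phi> \<psi>] (friedman \<psi>)"
  proof (rule prv_Or_Star_E)
    show "prv Ax [friedman \<phi>, Imp \<phi> \<psi>] (Or \<phi> Star)"
      by (rule friedman_Or_StarD(2)[OF \<phi>]) auto
    show "prv Ax [\<phi>, friedman \<phi>, Imp \<phi> \<psi>] (friedman \<psi>)"
      by (rule friedman_Or_StarD(1)[OF \<psi>], rule derives.ImpE[of _ _ _ \<phi>]) auto
  qed
  then have "prv Ax [Imp \<phi> \<psi>] (friedman (Imp \<phi> \<psi>))" by (auto intro: derives.ImpI)
  moreover
  let ?F = "Imp (friedman \<phi>) (friedman \<psi>)"
  have "prv Ax [?F] (Or (Imp \<phi> \<psi>) Star)"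
  proof (rule prv_cases[OF lem])
    have "prv Ax [\<phi>, ?F] (friedman \<phi>)"
      by (rule friedman_Or_StarD(1)[OF \<phi>]) auto
    then have "prv Ax [\<phi>, ?F] (friedman \<psi>)"
      by (rule derives.ImpE[rotated]) auto
    then have "prv Ax [\<phi>, ?F] (Or \<psi> Star)" by (rule friedman_Or_StarD(2)[OF \<psi>])
    then show "prv Ax [\<phi>, ?F] (Or (Imp \<phi> \<psi>) Star)"
      by (rule derives.OrE)
        (auto intro: derives.OrI1[OF derives.ImpI] derives.OrI2)
    have "prv Ax [\<phi>, Neg \<phi>, ?F] Bot"
      by (rule derives.ImpE[of _ _ _ \<phi>]) auto
    then have "prv Ax [\<phi>, Neg \<phi>, ?F] \<psi>" by (rule derives.BotE) simp
    then show "prv Ax [Neg \<phi>, ?F] (Or (Imp \<phi> \<psi>) Star)"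
      by (auto intro: derives.OrI1[OF derives.ImpI])
  qed
  ultimately show ?thesis by (simp add: friedman_Or_Star_def)
qed

text \<open>\<open>Star\<close> contains no variables, so it can leave the scope of the existential
  quantifier.\<close>

lemma friedman_Or_Star_Exists:
  assumes \<phi>: "friedman_Or_Star Ax \<phi>"
  shows "friedman_Or_Star Ax (Exists \<phi>)"
proof -
  have [simp]: "wf_fm \<phi>" using assms by (rule friedman_Or_Star_wf)
  have "prv Ax [Exists \<phi>] (Exists (friedman \<phi>))"
    by (rule derives.ExE[of _ _ _ \<phi>])
      (auto intro!: prv_lifted_ExI friedman_Or_StarD(1)[OF \<phi>])
  moreover have "prv Ax [Exists (friedman \<phi>)] (Or (Exists \<phi>) Star)"
  proof (rule derives.ExE[of _ _ _ "friedman \<phi>"])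
    let ?G = "friedman \<phi> # map lift [Exists (friedman \<phi>)]"
    have "prv Ax ?G (Or \<phi> Star)"
      by (rule friedman_Or_StarD(2)[OF \<phi>]) auto
    then have "prv Ax ?G (Or (lift (Exists \<phi>)) Star)"
    proof (rule derives.OrE)
      show "prv Ax (\<phi> # ?G) (Or (lift (Exists \<phi>)) Star)"
        by (rule derives.OrI1[OF prv_lifted_ExI]) auto
    qed (auto intro!: derives.OrI2)
    then show "prv Ax ?G (lift (Or (Exists \<phi>) Star))" by (simp add: lift_def)
  qed auto
  ultimately show ?thesis by (simp add: friedman_Or_Star_def)
qed

text \<open>The complement of \<open>Forall \<phi>\<close> yields either the universal formula or a
  point satisfying \<open>\<psi>\<close>. The complement of the matrix turns such a point into a
  refutation of \<open>\<phi>\<close>, leaving \<open>Star\<close>.\<close>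

lemma friedman_Or_Star_Forall:
  assumes \<phi>: "friedman_Or_Star Ax \<phi>"
    and \<psi>: "complementary Ax \<phi> \<psi>" "complementary Ax (Forall \<phi>) (Exists \<psi>)"
  shows "friedman_Or_Star Ax (Forall \<phi>)"
proof -
  have [simp]: "wf_fm \<phi>" "wf_fm \<psi>" using complementary_wf[OF \<psi>(1)] by auto
  have "prv Ax [Forall \<phi>] (Forall (friedman \<phi>))"
    by (auto intro!: derives.AllI friedman_Or_StarD(1)[OF \<phi>] prv_lifted_AllE)
  moreover
  let ?F = "Forall (friedman \<phi>)"
  have "prv Ax [?F] (Or (Forall \<phi>) Star)"
  proof (rule prv_cases)
    show "prv Ax [] (Or (Forall \<phi>) (Exists \<psi>))"
      using \<psi>(2) by (simp add: complementary_def)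
    show "prv Ax [Forall \<phi>, ?F] (Or (Forall \<phi>) Star)"
      by (auto intro!: derives.OrI1)
    have "prv Ax [Exists \<psi>, ?F] Star"
    proof (rule derives.ExE[of _ _ _ \<psi>])
      let ?G = "\<psi> # map lift [Exists \<psi>, ?F]"
      \<comment> \<open>The translated universal formula is evaluated at the counterexample, where
        \<open>\<psi>\<close> excludes the first disjunct.\<close>
      have "prv Ax ?G (Or \<phi> Star)"
        by (rule friedman_Or_StarD(2)[OF \<phi>], rule prv_lifted_AllE) auto
      then have "prv Ax ?G Star"
      proof (rule derives.OrE)
        have "prv Ax (\<phi> # ?G) Bot"
          using \<psi>(1) unfolding complementary_def by (auto elim!: prv_weaken)
        then show "prv Ax (\<phi> # ?G) Star" by (rule derives.BotE) simp
      qed auto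
      then show "prv Ax ?G (lift Star)" by (simp add: lift_def)
    qed auto
    then show "prv Ax [Exists \<psi>, ?F] (Or (Forall \<phi>) Star)" by (auto intro: derives.OrI2)
  qed
  ultimately show ?thesis by (simp add: friedman_Or_Star_def)
qed

text \<open>In the implication case the antecedent is itself quantifier-free, so excluded middle at
  level 0 decides it.\<close>

lemma friedman_Or_Star_qfree:
  assumes "qfree \<phi>" "\<phi> \<in> lang_HA" "LEM (Sigma_fm 0) \<subseteq> Ax"
  shows "friedman_Or_Star Ax \<phi>"
  using assms(1,2)
proof (induction \<phi>)
  case (Imp \<phi> \<psi>)
  have "\<phi> \<in> Sigma_fm 0" using Imp.prems by (simp add: lang_HA_def)
  then have "prv Ax [] (Or \<phi> (Neg \<phi>))" using assms(3) by (rule prv_LEM_Sigma)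
  with Imp show ?case by (intro friedman_Or_Star_Imp) (auto simp: lang_HA_def)
qed (auto simp: lang_HA_def
    intro: friedman_Or_Star_prime friedman_Or_Star_And friedman_Or_Star_Or)

text \<open>Both classes go through one induction, since each is built on the other. For a universal
  block the matrix has a complement at level \<open>m\<close>, and excluded middle at level
  \<open>Suc m\<close> extends it to the whole block.\<close>

lemma friedman_Or_Star_Sigma_Pi:
  assumes "LEM (Sigma_fm m) \<subseteq> Ax"
  shows "(\<forall>\<phi>\<in>Sigma_fm m. friedman_Or_Star Ax \<phi>) \<and> (\<forall>\<phi>\<in>Pi_fm m. friedman_Or_Star Ax \<phi>)"
  using assms
proof (induction m)
  case 0
  then show ?case using friedman_Or_Star_qfree by auto
next
  case (Suc m)
  have IH: "\<forall>\<phi>\<in>Sigma_fm m. friedman_Or_Star Ax \<phi>" "\<forall>\<phi>\<in>Pi_fm m. friedman_Or_Star Ax \<phi>"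
    and sub: "LEM (Sigma_fm m) \<subseteq> Ax"
    using Suc.IH Suc.prems LEM_Sigma_subset_Suc[of m] by auto
  have "friedman_Or_Star Ax ((Exists ^^ n) \<phi>)" if "\<phi> \<in> Pi_fm m" for n \<phi>
    using that IH(2) by (induction n) (auto intro: friedman_Or_Star_Exists)
  moreover have "friedman_Or_Star Ax ((Forall ^^ n) \<phi>)" if \<phi>: "\<phi> \<in> Sigma_fm m" for n \<phi>
  proof -
    obtain \<psi> where \<psi>: "\<psi> \<in> Pi_fm m" "complementary Ax \<psi> \<phi>"
      using ex_complementary[OF sub] \<phi> complementary_sym by blast
    note c = complementary_blocks[OF \<psi>(2,1) Suc.prems]
    show ?thesis
    proof (induction n)
      case (Suc n)
      \<comment> \<open>The block of length \<open>n\<close> gives the complement of the matrix, the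
        block of length \<open>Suc n\<close> that of the quantified formula.\<close>
      from friedman_Or_Star_Forall[OF Suc complementary_sym[OF c]]
        complementary_sym[OF c[of "Suc n"]]
      show ?case by simp
    qed (use \<phi> IH in simp)
  qed
  ultimately show ?case by auto
qed

text \<open>Excluded middle is applied to the original \<open>\<phi>\<close> only. If
  \<open>\<phi>\<close> fails, \<open>friedman \<phi>\<close> can hold only through
  \<open>Star\<close>, which gives the translated falsity \<open>Or Bot Star\<close>; this is what
  the translated negation demands.\<close>

lemma prv_friedman_LEM:
  assumes "\<phi> \<in> Sigma_fm k" "LEM (Sigma_fm k) \<subseteq> Ax"
  shows "prv Ax [] (friedman (Or \<phi> (Neg \<phi>)))"
proof -
  have \<phi>: "friedman_Or_Star Ax \<phi>" using friedman_Or_Star_Sigma_Pi assms by blast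
  have [simp]: "wf_fm \<phi>" using \<phi> by (rule friedman_Or_Star_wf)
  note lem = prv_LEM_Sigma[OF assms]
  have "prv Ax [friedman \<phi>, Neg \<phi>] (friedman Bot)"
  proof (rule prv_Or_Star_E)
    show "prv Ax [friedman \<phi>, Neg \<phi>] (Or \<phi> Star)"
      by (rule friedman_Or_StarD(2)[OF \<phi>]) auto
    have "prv Ax [\<phi>, friedman \<phi>, Neg \<phi>] Bot"
      by (rule derives.ImpE[of _ _ _ \<phi>]) auto
    then show "prv Ax [\<phi>, friedman \<phi>, Neg \<phi>] (friedman Bot)" by (auto intro: derives.OrI1)
  qed
  then have "prv Ax [Neg \<phi>] (friedman (Neg \<phi>))" by (auto intro: derives.ImpI)
  moreover have "prv Ax [\<phi>] (friedman \<phi>)" using \<phi> by (simp add: friedman_Or_Star_def)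
  ultimately show ?thesis
    unfolding friedman.simps(5) by (intro prv_cases[OF lem derives.OrI1 derives.OrI2]) auto
qed

theorem theorem8p3:
  fixes k :: nat and \<phi> :: fm
  assumes "\<phi> \<in> lang_HA"
    and "HA_LEM_proves k \<phi>"
  shows "HA_star_LEM_proves k (friedman \<phi>)"
proof -
  let ?T = "arith_axioms lang_HA_star \<union> LEM (Sigma_fm k)"
  have "prv ?T [] (friedman \<psi>)"
    if \<psi>: "\<psi> \<in> arith_axioms lang_HA \<union> LEM (Sigma_fm k)" "\<psi> \<in> lang_HA" for \<psi>
  proof (cases "\<psi> \<in> arith_axioms lang_HA")
    case True
    with \<psi> show ?thesis by (intro prv_friedman_arith_axiom) (auto simp: lang_HA_def)
  next
    case False
    with \<psi> obtain \<chi> where "\<psi> = Or \<chi> (Neg \<chi>)" "\<chi> \<in> Sigma_fm k" by (auto simp: LEM_def)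
    then show ?thesis using prv_friedman_LEM[of \<chi> k ?T] by auto
  qed
  from derives_friedman[OF assms(2)[unfolded HA_LEM_proves_def] this] show ?thesis
    by (simp add: HA_star_LEM_proves_def)
qed

end
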